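(* The graph isomorphism problem is polynomially reducible to the automorphism partitioning problem of doubly connected graphs. That is, given any algorithm that, on input a doubly connected graph, outputs its automorphism partition, one can decide whether two given graphs are isomorphic in time polynomial in the number of vertices, using polynomially many (at most $n$, where $n$ is the number of vertices of each input graph) calls to that algorithm.
   Context: Graphs are finite, undirected, without loops. Two graphs $G_1=(V_1,E_1)$, $G_2=(V_2,E_2)$ are isomorphic if there is a bijection $\beta:V_1\to V_2$ with $\{\{v\beta,w\beta\}:\{v,w\}\in E_1\}=E_2$. An automorphism of $G=(V,E)$ is a permutation $\pi$ of $V$ with $E\pi=E$. Two vertices $v_1,v_2$ are automorphism equivalent if some automorphism maps $v_1$ to $v_2$; the equivalence classes form the automorphism partition of $G$, and the automorphism partitioning problem is to compute this partition. The complement $\overline{G}$ of $G=(V,E)$ has vertex set $V$ and edges $\{v_1,v_2\}$ with $v_1\neq v_2$ and $\{v_1,v_2\}\notin E$. A graph is doubly connected if both it and its complement are connected. *)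

theory Defs
  imports Main "HOL-Combinatorics.Permutations" "HOL-Computational_Algebra.Polynomial"
begin

record 'a ugraph =
  verts :: "'a set"
  edges :: "'a set set"

definition graph :: "'a ugraph \<Rightarrow> bool" where
  "graph G \<longleftrightarrow> finite (verts G) \<and>
     edges G \<subseteq> {{v, w} | v w. v \<in> verts G \<and> w \<in> verts G \<and> v \<noteq> w}"

definition isomorphic :: "'a ugraph \<Rightarrow> 'b ugraph \<Rightarrow> bool" where
  "isomorphic G1 G2 \<longleftrightarrow>
     (\<exists>\<beta>. bij_betw \<beta> (verts G1) (verts G2) \<and>
          {{\<beta> v, \<beta> w} | v w. {v, w} \<in> edges G1} = edges G2)"

definition automorphism :: "('a \<Rightarrow> 'a) \<Rightarrow> 'a ugraph \<Rightarrow> bool" where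
  "automorphism \<pi> G \<longleftrightarrow> \<pi> permutes verts G \<and> (`) \<pi> ` edges G = edges G"

definition automorphism_equivalence :: "'a ugraph \<Rightarrow> ('a \<times> 'a) set" where
  "automorphism_equivalence G =
     {(v1, v2). v1 \<in> verts G \<and> v2 \<in> verts G \<and> (\<exists>\<pi>. automorphism \<pi> G \<and> \<pi> v1 = v2)}"

definition automorphism_partition :: "'a ugraph \<Rightarrow> 'a set set" where
  "automorphism_partition G = verts G // automorphism_equivalence G"

definition complement :: "'a ugraph \<Rightarrow> 'a ugraph" where
  "complement G =
     \<lparr> verts = verts G,
       edges = {{v, w} | v w. v \<in> verts G \<and> w \<in> verts G \<and> v \<noteq> w \<and> {v, w} \<notin> edges G} \<rparr>"

text \<open>By convention, the graph without vertices is not connected.\<close>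

definition connected_graph :: "'a ugraph \<Rightarrow> bool" where
  "connected_graph G \<longleftrightarrow> verts G \<noteq> {} \<and>
     (\<forall>u\<in>verts G. \<forall>v\<in>verts G. (u, v) \<in> {(x, y). {x, y} \<in> edges G}\<^sup>*)"

definition doubly_connected :: "'a ugraph \<Rightarrow> bool" where
  "doubly_connected G \<longleftrightarrow> connected_graph G \<and> connected_graph (complement G)"

text \<open>
  The model of computation is the unit-cost random access machine on natural numbers with
  addition and truncated subtraction, presented as a structured while-language. There is
  deliberately no multiplication: without it, one step increases the bit length of the largest
  number present by at most a constant, so time is polynomially related to that of Turing
  machines. Expressions are evaluated in unit time, which for any fixed program differs only
  by a constant factor from charging for each operation.

  A program has finitely many registers \<open>Reg r\<close>, an indirectly addressed memory
  \<open>Mem e\<close>, a read-only input, a write-only query tape and a read-only answer tape. Reading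
  beyond the end of the input or of the answer yields 0.
\<close>

datatype exp =
    Const nat
  | Reg nat
  | Mem exp
  | Input exp
  | Input_Length
  | Answer exp
  | Answer_Length
  | Plus exp exp
  | Minus exp exp

datatype prog =
    Skip
  | Assign nat exp
  | Store exp exp
  | Emit exp
  | Query
  | Seq prog prog
  | Cond exp prog prog
  | While exp prog

record state =
  regs :: "nat \<Rightarrow> nat"
  mem :: "nat \<Rightarrow> nat"
  query_tape :: "nat list"
  answer_tape :: "nat list"

definition nth0 :: "nat list \<Rightarrow> nat \<Rightarrow> nat" where
  "nth0 xs i = (if i < length xs then xs ! i else 0)"

fun eval_exp :: "nat list \<Rightarrow> state \<Rightarrow> exp \<Rightarrow> nat" where
  "eval_exp x s (Const k) = k"
| "eval_exp x s (Reg r) = regs s r"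
| "eval_exp x s (Mem e) = mem s (eval_exp x s e)"
| "eval_exp x s (Input e) = nth0 x (eval_exp x s e)"
| "eval_exp x s Input_Length = length x"
| "eval_exp x s (Answer e) = nth0 (answer_tape s) (eval_exp x s e)"
| "eval_exp x s Answer_Length = length (answer_tape s)"
| "eval_exp x s (Plus e1 e2) = eval_exp x s e1 + eval_exp x s e2"
| "eval_exp x s (Minus e1 e2) = eval_exp x s e1 - eval_exp x s e2"

text \<open>
  \<open>exec A x c s t qs s'\<close>: started in state \<open>s\<close> on input \<open>x\<close> with oracle
  \<open>A\<close>, the program \<open>c\<close> halts in state \<open>s'\<close> after \<open>t\<close> steps, and
  \<open>qs\<close> is the sequence of words on which it has called the oracle. An oracle call is a single
  step; it replaces the answer tape and erases the query tape. Conditions are true iff nonzero.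
\<close>

inductive exec ::
  "(nat list \<Rightarrow> nat list) \<Rightarrow> nat list \<Rightarrow> prog \<Rightarrow> state \<Rightarrow> nat \<Rightarrow> nat list list \<Rightarrow> state \<Rightarrow> bool"
  for A :: "nat list \<Rightarrow> nat list" and x :: "nat list" where
  Skip: "exec A x Skip s 1 [] s"
| Assign: "exec A x (Assign r e) s 1 [] (s\<lparr>regs := (regs s)(r := eval_exp x s e)\<rparr>)"
| Store: "exec A x (Store e1 e2) s 1 []
            (s\<lparr>mem := (mem s)(eval_exp x s e1 := eval_exp x s e2)\<rparr>)"
| Emit: "exec A x (Emit e) s 1 [] (s\<lparr>query_tape := query_tape s @ [eval_exp x s e]\<rparr>)"
| Query: "exec A x Query s 1 [query_tape s]
            (s\<lparr>query_tape := [], answer_tape := A (query_tape s)\<rparr>)"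
| Seq: "exec A x c1 s t1 qs1 s1 \<Longrightarrow> exec A x c2 s1 t2 qs2 s2 \<Longrightarrow>
          exec A x (Seq c1 c2) s (t1 + t2) (qs1 @ qs2) s2"
| Cond_True: "eval_exp x s b \<noteq> 0 \<Longrightarrow> exec A x c1 s t qs s' \<Longrightarrow>
          exec A x (Cond b c1 c2) s (1 + t) qs s'"
| Cond_False: "eval_exp x s b = 0 \<Longrightarrow> exec A x c2 s t qs s' \<Longrightarrow>
          exec A x (Cond b c1 c2) s (1 + t) qs s'"
| While_False: "eval_exp x s b = 0 \<Longrightarrow> exec A x (While b c) s 1 [] s"
| While_True: "eval_exp x s b \<noteq> 0 \<Longrightarrow> exec A x c s t1 qs1 s1 \<Longrightarrow>
          exec A x (While b c) s1 t2 qs2 s2 \<Longrightarrow>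
          exec A x (While b c) s (1 + t1 + t2) (qs1 @ qs2) s2"

inductive_cases SkipE: "exec A x Skip s t qs s'"
inductive_cases AssignE: "exec A x (Assign r e) s t qs s'"
inductive_cases StoreE: "exec A x (Store e1 e2) s t qs s'"
inductive_cases EmitE: "exec A x (Emit e) s t qs s'"
inductive_cases QueryE: "exec A x Query s t qs s'"
inductive_cases SeqE: "exec A x (Seq c1 c2) s t qs s'"
inductive_cases CondE: "exec A x (Cond b c1 c2) s t qs s'"
inductive_cases WhileE: "exec A x (While b c) s t qs s'"

text \<open>A program has at most one halting run, so an existential claim about runs speaks of
  \<^emph>\<open>the\<close> run.\<close>

lemma exec_deterministic:
  assumes "exec A x c s t qs s'" and "exec A x c s u rs s''"
  shows "t = u \<and> qs = rs \<and> s' = s''"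
  using assms
proof (induction arbitrary: u rs s'' rule: exec.induct)
  case (Skip s)
  then show ?case by (rule SkipE) simp
next
  case (Assign s r e)
  then show ?case by (rule AssignE) simp
next
  case (Store s e1 e2)
  then show ?case by (rule StoreE) simp
next
  case (Emit s e)
  then show ?case by (rule EmitE) simp
next
  case (Query s)
  then show ?case by (rule QueryE) simp
next
  case (Seq c1 s t1 qs1 s1 c2 t2 qs2 s2)
  from Seq.prems show ?case by (rule SeqE) (auto dest: Seq.IH)
next
  case (Cond_True s b c1 t qs s' c2)
  from Cond_True.prems show ?case
    by (rule CondE) (use Cond_True.hyps in \<open>auto dest: Cond_True.IH\<close>)+
next
  case (Cond_False s b c2 t qs s' c1)
  from Cond_False.prems show ?case
    by (rule CondE) (use Cond_False.hyps in \<open>auto dest: Cond_False.IH\<close>)+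
next
  case (While_False s b c)
  from While_False.prems show ?case
    by (rule WhileE) (use While_False.hyps in simp_all)
next
  case (While_True s b c t1 qs1 s1 t2 qs2 s2)
  from While_True.prems show ?case
    by (rule WhileE) (use While_True.hyps in \<open>auto dest: While_True.IH\<close>)+
qed

definition init_state :: state where
  "init_state = \<lparr> regs = (\<lambda>_. 0), mem = (\<lambda>_. 0), query_tape = [], answer_tape = [] \<rparr>"

definition accepting :: "state \<Rightarrow> bool" where
  "accepting s \<longleftrightarrow> regs s 0 \<noteq> 0"

text \<open>Machines work on graphs whose vertices are numbered \<open>0, \<dots>, n - 1\<close>; such a graph
  is given by \<open>n\<close> followed by the rows of its adjacency matrix.\<close>

definition numbered_graph :: "nat \<Rightarrow> nat ugraph \<Rightarrow> bool" where
  "numbered_graph n G \<longleftrightarrow> graph G \<and> verts G = {..<n}"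

definition encode_graph :: "nat \<Rightarrow> nat ugraph \<Rightarrow> nat list" where
  "encode_graph n G =
     n # concat (map (\<lambda>i. map (\<lambda>j. if {i, j} \<in> edges G then 1 else 0) [0..<n]) [0..<n])"

text \<open>A partition of \<open>{0, \<dots>, n - 1}\<close> is given by labels below \<open>n\<close>, one for each
  vertex, two vertices having the same label iff they lie in the same class. The labels are
  otherwise arbitrary, so a partition has several representations.\<close>

definition represents_partition :: "nat list \<Rightarrow> nat \<Rightarrow> nat set set \<Rightarrow> bool" where
  "represents_partition xs n P \<longleftrightarrow> length xs = n \<and> (\<forall>l\<in>set xs. l < n) \<and>
     P = {{v. v < n \<and> xs ! v = l} | l. l \<in> set xs}"

text \<open>Nothing is assumed about the answers to words that do not encode doubly connected
  graphs.\<close>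

definition solves_automorphism_partitioning_dc :: "(nat list \<Rightarrow> nat list) \<Rightarrow> bool" where
  "solves_automorphism_partitioning_dc A \<longleftrightarrow>
     (\<forall>n G. numbered_graph n G \<and> doubly_connected G \<longrightarrow>
        represents_partition (A (encode_graph n G)) n (automorphism_partition G))"

end

theory Submission
  imports Defs
begin

text \<open>
  One oracle call suffices. Take the disjoint union of the two graphs on \<open>n\<close> vertices each, add an
  apex over each of them, and join the two apexes by an edge. For \<open>n > 0\<close> the resulting graph is
  doubly connected, and the apexes are its only vertices of degree \<open>n + 1\<close>. Hence an automorphism
  that takes one apex to the other swaps them, and so restricts to an isomorphism between their
  remaining neighbourhoods, which are the two given graphs.
\<close>

section \<open>The joined graph\<close>

text \<open>The edge between the apexes makes the graph connected. Its complement is connected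
  because no edge runs between the two copies, so in the complement they span a complete bipartite
  graph. A vertex of a copy has at most \<open>n - 1\<close> neighbours in that copy and one apex,
  hence degree at most \<open>n\<close>; the apex edge lifts the apexes to \<open>n + 1\<close>,
  where otherwise they could be confused with a vertex adjacent to all of its copy.

  For \<open>n = 0\<close> the complement consists of two isolated vertices and no oracle call is
  allowed, so this case is decided without the oracle.

  The numbering (left copy, right copy shifted by \<open>n\<close>, apexes) cuts the adjacency
  matrix into blocks that are either input rows or constant. The machine can therefore write the
  query while reading each input matrix once, without memory and without multiplication.\<close>

definition apex_join :: "nat \<Rightarrow> nat ugraph \<Rightarrow> nat ugraph \<Rightarrow> nat ugraph" where
  "apex_join n G1 G2 =
     \<lparr> verts = {..<2 * n + 2},
       edges = edges G1 \<union> (\<lambda>e. (\<lambda>v. v + n) ` e) ` edges G2 \<union>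
         {{v, 2 * n} | v. v < n} \<union> {{v + n, 2 * n + 1} | v. v < n} \<union> {{2 * n, 2 * n + 1}} \<rparr>"

lemma edge_numbered_graph:
  assumes "numbered_graph n G" and "{i, j} \<in> edges G"
  shows "i < n \<and> j < n \<and> i \<noteq> j"
  using assms unfolding numbered_graph_def graph_def by (fastforce simp: doubleton_eq_iff)

lemma edge_numbered_graph_cases:
  assumes "numbered_graph n G" and "e \<in> edges G"
  obtains i j where "e = {i, j}" "i < n" "j < n" "i \<noteq> j"
  using assms unfolding numbered_graph_def graph_def by blast

text \<open>Simp rules that remove the impossible disjuncts of \<open>edges_apex_join_iff\<close>.
  The singleton rule serves the diagonal, where \<open>{i, i}\<close> is simplified to
  \<open>{i}\<close>.\<close>

lemma non_edge_numbered_graph: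
  assumes "numbered_graph n G"
  shows "n \<le> i \<Longrightarrow> {i, j} \<notin> edges G" and "n \<le> j \<Longrightarrow> {i, j} \<notin> edges G"
    and "2 * n \<le> i \<Longrightarrow> {i - n, j} \<notin> edges G" and "2 * n \<le> j \<Longrightarrow> {i, j - n} \<notin> edges G"
    and "{i} \<notin> edges G"
  using edge_numbered_graph[OF assms, of i j] edge_numbered_graph[OF assms, of "i - n" j]
    edge_numbered_graph[OF assms, of i "j - n"] edge_numbered_graph[OF assms, of i i]
  by auto

text \<open>Turns adjacency into arithmetic on vertex numbers. The guards \<open>n \<le> i\<close>
  and \<open>n \<le> j\<close> are essential, since truncated subtraction would send every left
  vertex to 0.\<close>

lemma edges_apex_join_iff:
  assumes "numbered_graph n G1" and "numbered_graph n G2"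
  shows "{i, j} \<in> edges (apex_join n G1 G2) \<longleftrightarrow>
    {i, j} \<in> edges G1 \<or> (n \<le> i \<and> n \<le> j \<and> {i - n, j - n} \<in> edges G2) \<or>
    (i < n \<and> j = 2 * n) \<or> (j < n \<and> i = 2 * n) \<or>
    (n \<le> i \<and> i < 2 * n \<and> j = 2 * n + 1) \<or> (n \<le> j \<and> j < 2 * n \<and> i = 2 * n + 1) \<or>
    (i = 2 * n \<and> j = 2 * n + 1) \<or> (i = 2 * n + 1 \<and> j = 2 * n)"
proof -
  have shift: "{i, j} \<in> (\<lambda>e. (\<lambda>v. v + n) ` e) ` edges G2 \<longleftrightarrow>
      n \<le> i \<and> n \<le> j \<and> {i - n, j - n} \<in> edges G2" (is "?L \<longleftrightarrow> ?R")
  proof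
    assume ?L
    then obtain e where e: "e \<in> edges G2" "{i, j} = (\<lambda>v. v + n) ` e" by blast
    obtain a b where "e = {a, b}" using e(1) assms(2) by (blast elim: edge_numbered_graph_cases)
    with e have "{i, j} = {a + n, b + n}" "{a, b} \<in> edges G2" by auto
    then show ?R by (auto simp: doubleton_eq_iff insert_commute)
  next
    assume ?R
    then have "{i, j} = (\<lambda>v. v + n) ` {i - n, j - n}" by auto
    with \<open>?R\<close> show ?L by blast
  qed
  have left: "{i, j} \<in> {{v, 2 * n} | v. v < n} \<longleftrightarrow> (i < n \<and> j = 2 * n) \<or> (j < n \<and> i = 2 * n)"
    by (auto simp: doubleton_eq_iff)
  have right: "{i, j} \<in> {{v + n, 2 * n + 1} | v. v < n} \<longleftrightarrow>
      (n \<le> i \<and> i < 2 * n \<and> j = 2 * n + 1) \<or> (n \<le> j \<and> j < 2 * n \<and> i = 2 * n + 1)"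
    by (auto simp: doubleton_eq_iff intro: exI[of _ "i - n"] exI[of _ "j - n"])
  show ?thesis
    unfolding apex_join_def ugraph.simps Un_iff shift left right singleton_iff doubleton_eq_iff
    by (simp only: disj_assoc)
qed

lemma numbered_graph_apex_join:
  assumes "numbered_graph n G1" and "numbered_graph n G2"
  shows "numbered_graph (2 * n + 2) (apex_join n G1 G2)"
proof -
  have "\<exists>v w. e = {v, w} \<and> v < 2 * n + 2 \<and> w < 2 * n + 2 \<and> v \<noteq> w"
    if e_edge: "e \<in> edges (apex_join n G1 G2)" for e
  proof -
    \<comment> \<open>\<open>edges_apex_join_iff\<close> speaks only of sets of the form
      \<open>{i, j}\<close>, so this form is established first.\<close>
    have "\<exists>i j. e = {i, j}"
    proof -
      consider "e \<in> edges G1" | e' where "e' \<in> edges G2" "e = (\<lambda>v. v + n) ` e'" | "\<exists>i j. e = {i, j}"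
        using e_edge unfolding apex_join_def by auto
      then show ?thesis
      proof cases
        case 1
        then show ?thesis using assms(1) by (blast elim: edge_numbered_graph_cases)
      next
        case 2
        obtain i j where "e' = {i, j}"
          using 2(1) assms(2) by (blast elim: edge_numbered_graph_cases)
        with 2(2) have "e = {i + n, j + n}" by simp
        then show ?thesis by blast
      qed
    qed
    then obtain i j where e: "e = {i, j}" by blast
    have "i < 2 * n + 2 \<and> j < 2 * n + 2 \<and> i \<noteq> j"
      using that edge_numbered_graph[OF assms(1), of i j]
        edge_numbered_graph[OF assms(2), of "i - n" "j - n"]
      unfolding e edges_apex_join_iff[OF assms] by (elim disjE) auto
    with e show ?thesis by blast
  qed
  then have "edges (apex_join n G1 G2) \<subseteq>
      {{v, w} | v w. v \<in> {..<2 * n + 2} \<and> w \<in> {..<2 * n + 2} \<and> v \<noteq> w}"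
    by blast
  moreover have "verts (apex_join n G1 G2) = {..<2 * n + 2}" by (simp add: apex_join_def)
  ultimately show ?thesis unfolding numbered_graph_def graph_def by simp
qed

text \<open>Adjacency is symmetric, so a path into the hub \<open>a\<close> can be continued by the
  reverse of another one.\<close>

lemma connected_graphI:
  assumes "a \<in> verts G"
    and "\<And>v. v \<in> verts G \<Longrightarrow> (v, a) \<in> {(x, y). {x, y} \<in> edges G}\<^sup>*"
  shows "connected_graph G"
proof -
  have "sym ({(x, y). {x, y} \<in> edges G}\<^sup>*)"
    by (intro sym_rtrancl symI) (simp add: insert_commute)
  then have "(u, v) \<in> {(x, y). {x, y} \<in> edges G}\<^sup>*" if "u \<in> verts G" "v \<in> verts G" for u v
    using assms(2)[OF that(1)] assms(2)[OF that(2)] by (meson rtrancl_trans symD)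
  with assms(1) show ?thesis unfolding connected_graph_def by blast
qed

text \<open>The hub of the graph is the apex \<open>2 * n\<close>, which right vertices reach
  through the other apex. The hub of the complement is the left vertex 0: right vertices and the
  apex \<open>2 * n + 1\<close> are joined to it there, while left vertices and the apex
  \<open>2 * n\<close> reach it through the right vertex \<open>n\<close>. Both 0 and
  \<open>n\<close> are vertices of the copies because \<open>0 < n\<close>.\<close>

lemma doubly_connected_apex_join:
  assumes G: "numbered_graph n G1" "numbered_graph n G2" and n: "0 < n"
  shows "doubly_connected (apex_join n G1 G2)"
proof -
  let ?H = "apex_join n G1 G2"
  let ?R = "{(x, y). {x, y} \<in> edges ?H}\<^sup>*"
  let ?C = "{(x, y). {x, y} \<in> edges (complement ?H)}\<^sup>*"
  have verts: "verts ?H = {..<2 * n + 2}" by (simp add: apex_join_def)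
  have edgeR: "(x, y) \<in> ?R" if "{x, y} \<in> edges ?H" for x y
    using that by auto
  have edgeC: "(x, y) \<in> ?C"
    if "x < 2 * n + 2" "y < 2 * n + 2" "x \<noteq> y" "{x, y} \<notin> edges ?H" for x y
    by (rule r_into_rtrancl) (use that in \<open>auto simp: complement_def verts\<close>)
  note [simp] = non_edge_numbered_graph[OF G(1)] non_edge_numbered_graph[OF G(2)]
  have "connected_graph ?H"
  proof (rule connected_graphI)
    show "2 * n \<in> verts ?H" by (simp add: verts)
    fix v assume "v \<in> verts ?H"
    then consider "v < n" | "n \<le> v" "v < 2 * n" | "v = 2 * n" | "v = 2 * n + 1"
      by (auto simp: verts) linarith
    then show "(v, 2 * n) \<in> ?R"
    proof cases
      case 2
      have "(v, 2 * n + 1) \<in> ?R" "(2 * n + 1, 2 * n) \<in> ?R"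
        by (rule edgeR, use 2 in \<open>simp add: edges_apex_join_iff[OF G]\<close>)+
      then show ?thesis by (rule rtrancl_trans)
    qed (auto intro!: edgeR simp: edges_apex_join_iff[OF G])
  qed
  moreover have "connected_graph (complement ?H)"
  proof (rule connected_graphI)
    show "0 \<in> verts (complement ?H)" by (simp add: complement_def verts)
    have right: "(v, 0) \<in> ?C" if "n \<le> v" "v < 2 * n" for v
      using that n by (auto intro!: edgeC simp: edges_apex_join_iff[OF G])
    have "(n, 0) \<in> ?C" using n by (intro right) auto
    fix v assume "v \<in> verts (complement ?H)"
    then consider "v < n" | "n \<le> v" "v < 2 * n" | "v = 2 * n" | "v = 2 * n + 1"
      by (auto simp: verts complement_def) linarith
    then show "(v, 0) \<in> ?C"
    proof cases
      case 1
      have "(v, n) \<in> ?C"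
        using 1 n by (auto intro!: edgeC simp: edges_apex_join_iff[OF G])
      then show ?thesis using \<open>(n, 0) \<in> ?C\<close> by (rule rtrancl_trans)
    next
      case 3
      have "(v, n) \<in> ?C"
        using 3 n by (auto intro!: edgeC simp: edges_apex_join_iff[OF G])
      then show ?thesis using \<open>(n, 0) \<in> ?C\<close> by (rule rtrancl_trans)
    next
      case 4
      then show ?thesis
        using n by (auto intro!: edgeC simp: edges_apex_join_iff[OF G])
    qed (auto intro: right)
  qed
  ultimately show ?thesis unfolding doubly_connected_def by blast
qed

section \<open>Isomorphisms and automorphisms\<close>

text \<open>The definition only equates sets of edges. That non-edges go to non-edges follows
  because \<open>\<pi>\<close>, and with it the image map on sets, is injective.\<close>

lemma automorphism_edge_iff:
  assumes "automorphism \<pi> G"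
  shows "{\<pi> v, \<pi> w} \<in> edges G \<longleftrightarrow> {v, w} \<in> edges G"
proof -
  have "inj ((`) \<pi>)"
    using assms unfolding automorphism_def by (auto intro: injI simp: inj_image_eq_iff permutes_inj)
  then have "\<pi> ` {v, w} \<in> (`) \<pi> ` edges G \<longleftrightarrow> {v, w} \<in> edges G"
    by (rule inj_image_mem_iff)
  then show ?thesis using assms unfolding automorphism_def by simp
qed

text \<open>Invariance of the degree: \<open>\<pi>\<close> is a bijection of the whole type, so it
  carries the neighbourhood of \<open>v\<close> onto that of \<open>\<pi> v\<close>.\<close>

lemma automorphism_card_neighbours:
  assumes "automorphism \<pi> G"
  shows "card {w. {\<pi> v, w} \<in> edges G} = card {w. {v, w} \<in> edges G}"
proof -
  have perm: "\<pi> permutes verts G" using assms by (simp add: automorphism_def)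
  have "{w. {\<pi> v, w} \<in> edges G} = \<pi> ` {w. {v, w} \<in> edges G}"
    using automorphism_edge_iff[OF assms] permutes_surj[OF perm] by (auto simp: image_iff) (metis surjD)
  then show ?thesis using permutes_inj[OF perm] by (simp add: card_image inj_on_subset)
qed

text \<open>Replaces the equality of edge sets by a condition on pairs, which suits the arithmetic
  of the joined graph. Injectivity of \<open>\<beta>\<close> yields that non-edges are preserved,
  surjectivity that every edge of \<open>G2\<close> is reached.\<close>

lemma isomorphic_iff_edges:
  assumes "numbered_graph n G1" and "numbered_graph n G2"
  shows "isomorphic G1 G2 \<longleftrightarrow> (\<exists>\<beta>. bij_betw \<beta> {..<n} {..<n} \<and>
    (\<forall>v<n. \<forall>w<n. {\<beta> v, \<beta> w} \<in> edges G2 \<longleftrightarrow> {v, w} \<in> edges G1))"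
proof -
  have verts: "verts G1 = {..<n}" "verts G2 = {..<n}"
    using assms by (auto simp: numbered_graph_def)
  have edges: "{{\<beta> v, \<beta> w} | v w. {v, w} \<in> edges G1} = edges G2 \<longleftrightarrow>
      (\<forall>v<n. \<forall>w<n. {\<beta> v, \<beta> w} \<in> edges G2 \<longleftrightarrow> {v, w} \<in> edges G1)" (is "?L \<longleftrightarrow> ?R")
    if \<beta>: "bij_betw \<beta> {..<n} {..<n}" for \<beta>
  proof
    assume L: ?L
    have "{v, w} \<in> edges G1" if "v < n" "w < n" "{\<beta> v, \<beta> w} \<in> edges G2" for v w
    proof -
      from that(3) L obtain v' w' where *: "{v', w'} \<in> edges G1" "{\<beta> v, \<beta> w} = {\<beta> v', \<beta> w'}"
        by blast
      have "v' < n" "w' < n" using edge_numbered_graph[OF assms(1) *(1)] by auto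
      then have "{v, w} = {v', w'}"
        using *(2) that \<beta> unfolding bij_betw_def inj_on_def doubleton_eq_iff by blast
      with *(1) show ?thesis by simp
    qed
    with L show ?R by blast
  next
    assume R: ?R
    have "e \<in> {{\<beta> v, \<beta> w} | v w. {v, w} \<in> edges G1}" if e_edge: "e \<in> edges G2" for e
    proof -
      obtain i j where e: "e = {i, j}" "i < n" "j < n"
        using e_edge assms(2) by (blast elim: edge_numbered_graph_cases)
      then obtain v w where "v < n" "w < n" "i = \<beta> v" "j = \<beta> w"
        using \<beta> unfolding bij_betw_def by (metis imageE lessThan_iff)
      with R e e_edge show ?thesis by blast
    qed
    moreover have "{\<beta> v, \<beta> w} \<in> edges G2" if "{v, w} \<in> edges G1" for v w
      using R that edge_numbered_graph[OF assms(1) that] by blast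
    ultimately show ?L by blast
  qed
  show ?thesis
    unfolding isomorphic_def verts by (rule ex_cong1, rule conj_cong[OF refl], rule edges)
qed

text \<open>For the converse direction, \<open>\<beta>\<close> and its inverse are glued into one
  map that exchanges the copies and the apexes. As this map is an involution, a single inclusion
  suffices both for bijectivity and for the invariance of the edge set.\<close>

lemma apexes_equivalent_iff_isomorphic:
  assumes G: "numbered_graph n G1" "numbered_graph n G2"
  shows "(2 * n, 2 * n + 1) \<in> automorphism_equivalence (apex_join n G1 G2) \<longleftrightarrow> isomorphic G1 G2"
proof
  let ?H = "apex_join n G1 G2"
  note iff = edges_apex_join_iff[OF G]
  have less1: "i < n" "j < n" "i \<noteq> j" if "{i, j} \<in> edges G1" for i j
    using edge_numbered_graph[OF G(1) that] by auto
  have less2: "i < n" "j < n" "i \<noteq> j" if "{i, j} \<in> edges G2" for i j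
    using edge_numbered_graph[OF G(2) that] by auto
  note [simp] = non_edge_numbered_graph[OF G(1)] non_edge_numbered_graph[OF G(2)]
  have verts: "verts ?H = {..<2 * n + 2}" by (simp add: apex_join_def)
  {
    assume "(2 * n, 2 * n + 1) \<in> automorphism_equivalence ?H"
    then obtain \<pi> where \<pi>: "automorphism \<pi> ?H" and left: "\<pi> (2 * n) = 2 * n + 1"
      unfolding automorphism_equivalence_def by auto
    have perm: "\<pi> permutes {..<2 * n + 2}" using \<pi> by (simp add: automorphism_def verts)
    have "{w. {2 * n + 1, w} \<in> edges ?H} = insert (2 * n) {n..<2 * n}"
      by (auto simp: iff)
    then have "card {w. {2 * n + 1, w} \<in> edges ?H} = n + 1" by simp
    then have deg: "card {w. {\<pi> (2 * n + 1), w} \<in> edges ?H} = n + 1"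
      by (simp add: automorphism_card_neighbours[OF \<pi>])
    \<comment> \<open>The image has degree \<open>n + 1\<close>. It is not \<open>2 * n + 1\<close>,
      already the image of \<open>2 * n\<close>. In a copy its degree would be at most
      \<open>n\<close>: one apex and the \<open>n - 1\<close> vertices of the copy other than
      \<open>u\<close>.\<close>
    have right: "\<pi> (2 * n + 1) = 2 * n"
    proof (rule ccontr)
      define u where "u = \<pi> (2 * n + 1)"
      assume "\<pi> (2 * n + 1) \<noteq> 2 * n"
      moreover have "u \<noteq> 2 * n + 1"
        using injD[OF permutes_inj[OF perm], of "2 * n + 1" "2 * n"] left by (auto simp: u_def)
      moreover have "u < 2 * n + 2"
        using permutes_in_image[OF perm, of "2 * n + 1"] by (simp add: u_def)
      ultimately consider "u < n" | "n \<le> u" "u < 2 * n" unfolding u_def by linarith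
      then have "card {w. {u, w} \<in> edges ?H} \<le> n"
      proof cases
        case 1
        have "{w. {u, w} \<in> edges ?H} \<subseteq> insert (2 * n) ({..<n} - {u})"
        proof
          fix w assume "w \<in> {w. {u, w} \<in> edges ?H}"
          with 1 less1[of u w] show "w \<in> insert (2 * n) ({..<n} - {u})" by (auto simp: iff)
        qed
        then have "card {w. {u, w} \<in> edges ?H} \<le> card (insert (2 * n) ({..<n} - {u}))"
          by (rule card_mono[rotated]) simp
        with 1 show ?thesis by simp
      next
        case 2
        have "{w. {u, w} \<in> edges ?H} \<subseteq> insert (2 * n + 1) ({n..<2 * n} - {u})"
        proof
          fix w assume "w \<in> {w. {u, w} \<in> edges ?H}"
          with 2 less2[of "u - n" "w - n"] show "w \<in> insert (2 * n + 1) ({n..<2 * n} - {u})"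
            by (auto simp: iff)
        qed
        then have "card {w. {u, w} \<in> edges ?H} \<le> card (insert (2 * n + 1) ({n..<2 * n} - {u}))"
          by (rule card_mono[rotated]) simp
        with 2 show ?thesis by simp
      qed
      with deg show False by (simp add: u_def)
    qed
    \<comment> \<open>A left vertex is adjacent to \<open>2 * n\<close>, so its image is adjacent to
      \<open>2 * n + 1\<close>: it is a right vertex or \<open>2 * n\<close>, and the latter is
      already the image of the second apex.\<close>
    have "n \<le> \<pi> v \<and> \<pi> v < 2 * n" if "v < n" for v
    proof -
      have "{\<pi> v, \<pi> (2 * n)} \<in> edges ?H"
        unfolding automorphism_edge_iff[OF \<pi>] using that by (simp add: iff)
      moreover have "\<pi> v \<noteq> 2 * n"
        using injD[OF permutes_inj[OF perm], of v "2 * n + 1"] right that by auto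
      ultimately show ?thesis
        unfolding left iff by (elim disjE) auto
    qed
    note range = this
    have "inj_on (\<lambda>v. \<pi> v - n) {..<n}"
    proof (rule inj_onI)
      fix v w assume "v \<in> {..<n}" "w \<in> {..<n}" "\<pi> v - n = \<pi> w - n"
      then have "\<pi> v = \<pi> w" using range[of v] range[of w] by auto
      then show "v = w" using permutes_inj[OF perm] by (simp add: inj_eq)
    qed
    moreover have "(\<lambda>v. \<pi> v - n) ` {..<n} = {..<n}"
      by (rule endo_inj_surj) (use range calculation in \<open>fastforce+\<close>)
    moreover have "{\<pi> v - n, \<pi> w - n} \<in> edges G2 \<longleftrightarrow> {v, w} \<in> edges G1" if "v < n" "w < n" for v w
    proof -
      have "{v, w} \<in> edges G1 \<longleftrightarrow> {v, w} \<in> edges ?H" using that by (auto simp: iff)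
      also have "\<dots> \<longleftrightarrow> {\<pi> v, \<pi> w} \<in> edges ?H" by (simp add: automorphism_edge_iff[OF \<pi>])
      also have "\<dots> \<longleftrightarrow> {\<pi> v - n, \<pi> w - n} \<in> edges G2"
        using range[OF that(1)] range[OF that(2)] by (auto simp: iff)
      finally show ?thesis by simp
    qed
    ultimately show "isomorphic G1 G2"
      unfolding isomorphic_iff_edges[OF G] bij_betw_def by blast
  next
    assume "isomorphic G1 G2"
    then obtain \<beta> where \<beta>: "bij_betw \<beta> {..<n} {..<n}"
      and edge: "\<And>v w. v < n \<Longrightarrow> w < n \<Longrightarrow> {\<beta> v, \<beta> w} \<in> edges G2 \<longleftrightarrow> {v, w} \<in> edges G1"
      unfolding isomorphic_iff_edges[OF G] by blast
    define \<gamma> where "\<gamma> = the_inv_into {..<n} \<beta>"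
    have \<beta>_less: "\<beta> v < n" if "v < n" for v
      using \<beta> that by (auto simp: bij_betw_def)
    have \<gamma>_\<beta>: "\<gamma> (\<beta> v) = v" if "v < n" for v
      using \<beta> that by (simp add: \<gamma>_def bij_betw_def the_inv_into_f_f)
    have \<beta>_\<gamma>: "\<beta> (\<gamma> v) = v" if "v < n" for v
      using \<beta> that unfolding \<gamma>_def by (simp add: bij_betw_def f_the_inv_into_f)
    have \<gamma>_less: "\<gamma> v < n" if "v < n" for v
      using bij_betw_the_inv_into[OF \<beta>] that by (auto simp: \<gamma>_def bij_betw_def)
    \<comment> \<open>The identity outside the vertex set is what \<open>permutes\<close>
      demands.\<close>
    define \<pi> where "\<pi> v = (if v < n then \<beta> v + n else if v < 2 * n then \<gamma> (v - n)
      else if v = 2 * n then 2 * n + 1 else if v = 2 * n + 1 then 2 * n else v)" for v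
    have \<pi>_left: "\<pi> v = \<beta> v + n" "\<beta> v < n" if "v < n" for v
      using that by (simp_all add: \<pi>_def \<beta>_less)
    have \<pi>_right: "\<pi> v = \<gamma> (v - n)" "\<gamma> (v - n) < n" if "n \<le> v" "v < 2 * n" for v
      using that by (simp_all add: \<pi>_def \<gamma>_less)
    have \<pi>_apex: "\<pi> (2 * n) = Suc (2 * n)" "\<pi> (Suc (2 * n)) = 2 * n"
      by (simp_all add: \<pi>_def)
    have \<pi>_outside: "\<pi> v = v" if "2 * n + 1 < v" for v
      using that by (simp add: \<pi>_def)
    have vertex_cases: "v < n \<or> (n \<le> v \<and> v < 2 * n) \<or> v = 2 * n \<or> v = Suc (2 * n) \<or> 2 * n + 1 < v" for v
      by linarith
    have inv: "\<pi> (\<pi> v) = v" for v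
      using vertex_cases[of v]
    proof (elim disjE conjE)
      assume "v < n"
      then show ?thesis using \<pi>_left[of v] \<pi>_right[of "\<beta> v + n"] by (simp add: \<gamma>_\<beta>)
    next
      assume "n \<le> v" "v < 2 * n"
      then show ?thesis
        using \<pi>_right[of v] \<pi>_left[of "\<gamma> (v - n)"] \<beta>_\<gamma>[of "v - n"] by simp
    qed (simp_all add: \<pi>_apex \<pi>_outside)
    have "\<pi> permutes {..<2 * n + 2}"
    proof (rule bij_imp_permutes)
      have "\<pi> v < 2 * n + 2" if "v < 2 * n + 2" for v
        using vertex_cases[of v] that \<pi>_left[of v] \<pi>_right[of v] \<pi>_apex by auto
      then show "bij_betw \<pi> {..<2 * n + 2} {..<2 * n + 2}"
        by (intro bij_betw_byWitness[where f' = \<pi>]) (auto simp: inv)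
      show "\<pi> v = v" if "v \<notin> {..<2 * n + 2}" for v using that by (simp add: \<pi>_outside)
    qed
    moreover have edge_image: "\<pi> ` e \<in> edges ?H" if e_edge: "e \<in> edges ?H" for e
    proof -
      obtain i j where e: "e = {i, j}"
        using e_edge numbered_graph_apex_join[OF G] by (blast elim: edge_numbered_graph_cases)
      have edge': "{\<gamma> v, \<gamma> w} \<in> edges G1" if "{v, w} \<in> edges G2" for v w
        using that less2[OF that] edge[of "\<gamma> v" "\<gamma> w"] by (simp add: \<gamma>_less \<beta>_\<gamma>)
      from e_edge have "{\<pi> i, \<pi> j} \<in> edges ?H"
        unfolding e iff[of i j]
      proof (elim disjE conjE)
        assume "{i, j} \<in> edges G1"
        then show ?thesis using edge[of i j] less1[of i j] by (simp add: iff \<pi>_left)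
      next
        assume "n \<le> i" "n \<le> j" "{i - n, j - n} \<in> edges G2"
        moreover from this have "i < 2 * n" "j < 2 * n" using less2[of "i - n" "j - n"] by auto
        ultimately show ?thesis using edge'[of "i - n" "j - n"] by (simp add: iff \<pi>_right)
      qed (simp_all add: iff \<pi>_left \<pi>_right \<pi>_apex)
      then show ?thesis by (simp add: e)
    qed
    \<comment> \<open>Every edge is the image of its own image, which \<open>edge_image\<close>
      shows to be an edge.\<close>
    moreover have "edges ?H \<subseteq> (`) \<pi> ` edges ?H"
    proof
      fix e assume "e \<in> edges ?H"
      moreover have "e = \<pi> ` \<pi> ` e" by (simp add: image_image inv)
      ultimately show "e \<in> (`) \<pi> ` edges ?H" using edge_image by blast
    qed
    ultimately have "automorphism \<pi> ?H" unfolding automorphism_def verts by blast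
    moreover have "\<pi> (2 * n) = 2 * n + 1" by (simp add: \<pi>_apex)
    ultimately show "(2 * n, 2 * n + 1) \<in> automorphism_equivalence ?H"
      unfolding automorphism_equivalence_def verts by auto
  }
qed

text \<open>The class of \<open>a\<close> is the fibre of some label. The identity automorphism puts
  \<open>a\<close> into its own class, so this label is that of \<open>a\<close>. Since labels are
  otherwise arbitrary, comparing two of them is the information that the program extracts.\<close>

lemma represents_automorphism_partition_iff:
  assumes "numbered_graph n G" and "represents_partition xs n (automorphism_partition G)"
    and "a < n" and "b < n"
  shows "xs ! a = xs ! b \<longleftrightarrow> (a, b) \<in> automorphism_equivalence G"
proof -
  have a: "a \<in> verts G" using assms by (simp add: numbered_graph_def)
  have "automorphism id G" by (simp add: automorphism_def permutes_id)
  then have refl: "(a, a) \<in> automorphism_equivalence G"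
    using a unfolding automorphism_equivalence_def by (auto intro: exI[of _ id])
  have "automorphism_equivalence G `` {a} \<in> automorphism_partition G"
    unfolding automorphism_partition_def by (rule quotientI[OF a])
  then obtain l where l: "automorphism_equivalence G `` {a} = {v. v < n \<and> xs ! v = l}"
    using assms(2) unfolding represents_partition_def by auto
  then have class_iff: "(a, v) \<in> automorphism_equivalence G \<longleftrightarrow> v < n \<and> xs ! v = l" for v
    by (simp add: set_eq_iff)
  have "xs ! a = l" using refl class_iff by simp
  with class_iff[of b] assms(4) show ?thesis by auto
qed

section \<open>Encodings\<close>

lemma length_concat_rows: "length (concat (map (\<lambda>i. map (f i) [0..<n]) [0..<m])) = m * n"
  by (induction m) auto

lemma nth_concat_rows:
  assumes "i < m" and "j < n"
  shows "concat (map (\<lambda>i. map (f i) [0..<n]) [0..<m]) ! (i * n + j) = f i j"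
  using assms
proof (induction m)
  case (Suc m)
  show ?case
  proof (cases "i = m")
    case True
    then show ?thesis using Suc.prems by (simp add: nth_append length_concat_rows)
  next
    case False
    then have "i < m" using Suc.prems by simp
    then have "Suc i * n \<le> m * n" by (intro mult_le_mono1) simp
    then have "i * n + j < m * n" using Suc.prems by simp
    then show ?thesis
      using Suc.IH[OF \<open>i < m\<close> Suc.prems(2)] by (simp add: nth_append length_concat_rows)
  qed
qed simp

text \<open>The unit in which the program copies its input: one inner loop per row.\<close>

definition adjacency_row :: "nat \<Rightarrow> nat ugraph \<Rightarrow> nat \<Rightarrow> nat list" where
  "adjacency_row n G i = map (\<lambda>j. if {i, j} \<in> edges G then 1 else 0) [0..<n]"

lemma encode_graph_rows: "encode_graph n G = n # concat (map (adjacency_row n G) [0..<n])"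
  by (simp add: encode_graph_def adjacency_row_def[abs_def])

lemma length_encode_graph: "length (encode_graph n G) = n * n + 1"
  by (simp add: encode_graph_def length_concat_rows)

text \<open>What one pass of the copying loop reads. The position \<open>p\<close> skips the
  preceding word \<open>xs\<close>, the leading vertex count (the summand 1) and \<open>i\<close>
  rows. The context \<open>xs\<close>, \<open>ys\<close> lets the lemma serve both graphs of the
  input.\<close>

lemma map_nth0_encode_graph:
  assumes "i < n" and "p = length xs + 1 + i * n"
  shows "map (nth0 (xs @ encode_graph n G @ ys)) [p..<p + n] = adjacency_row n G i"
proof (rule nth_equalityI)
  fix j assume "j < length (map (nth0 (xs @ encode_graph n G @ ys)) [p..<p + n])"
  then have j: "j < n" by simp
  have "Suc i * n \<le> n * n" using assms(1) by (intro mult_le_mono1) simp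
  with j have less: "i * n + j < n * n" by simp
  then have "nth0 (xs @ encode_graph n G @ ys) (p + j) =
      concat (map (\<lambda>i. map (\<lambda>j. if {i, j} \<in> edges G then 1 else 0) [0..<n]) [0..<n]) ! (i * n + j)"
    by (simp add: assms(2) nth0_def nth_append encode_graph_def length_concat_rows)
  also have "\<dots> = (if {i, j} \<in> edges G then 1 else 0)"
    by (rule nth_concat_rows) fact+
  finally show "map (nth0 (xs @ encode_graph n G @ ys)) [p..<p + n] ! j = adjacency_row n G i ! j"
    using j by (simp add: adjacency_row_def)
qed (simp add: adjacency_row_def)

text \<open>Left copy, right copy, apexes: the same splitting is applied to the rows and to the
  columns of the adjacency matrix.\<close>

lemma upt_join: "[0..<2 * n + 2] = [0..<n] @ map (\<lambda>v. v + n) [0..<n] @ [2 * n, 2 * n + 1]"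
proof -
  have "[0..<2 * n + 2] = [0..<n] @ [n..<(n + 2) + n]"
    using upt_add_eq_append[of 0 n "n + 2"] by (simp add: mult_2 add.commute)
  also have "[n..<(n + 2) + n] = map (\<lambda>v. v + n) [0..<n + 2]"
    by (rule map_add_upt[symmetric])
  also have "[0..<n + 2] = [0..<n] @ [n, n + 1]"
    by simp
  finally show ?thesis by (simp add: mult_2)
qed

text \<open>The block form of the matrix, with the blocks listed in the order in which
  \<open>write_apex_join\<close> emits them.\<close>

lemma encode_apex_join:
  assumes "numbered_graph n G1" and "numbered_graph n G2"
  shows "encode_graph (2 * n + 2) (apex_join n G1 G2) = (2 * n + 2) #
    concat (map (\<lambda>i. adjacency_row n G1 i @ replicate n 0 @ [1, 0]) [0..<n]) @
    concat (map (\<lambda>i. replicate n 0 @ adjacency_row n G2 i @ [0, 1]) [0..<n]) @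
    replicate n 1 @ replicate n 0 @ [0, 1] @ replicate n 0 @ replicate n 1 @ [1, 0]"
proof -
  let ?H = "apex_join n G1 G2"
  note iff = edges_apex_join_iff[OF assms]
  note [simp] = non_edge_numbered_graph[OF assms(1)] non_edge_numbered_graph[OF assms(2)]
  \<comment> \<open>Needed for the diagonal entries of the two apex rows.\<close>
  have [simp]: "{v} \<notin> edges ?H" for v
    using numbered_graph_apex_join[OF assms] by (rule non_edge_numbered_graph(5))
  have split: "adjacency_row (2 * n + 2) ?H i =
      map (\<lambda>j. if {i, j} \<in> edges ?H then 1 else 0) [0..<n] @
      map (\<lambda>j. if {i, j + n} \<in> edges ?H then 1 else 0) [0..<n] @
      [if {i, 2 * n} \<in> edges ?H then 1 else 0, if {i, 2 * n + 1} \<in> edges ?H then 1 else 0]" for i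
    unfolding adjacency_row_def upt_join by simp
  have const: "map (\<lambda>j. if P j then 1 else 0) [0..<n] = replicate n c"
    if "\<And>j. j < n \<Longrightarrow> (if P j then 1 else 0) = c" for P and c :: nat
    by (rule nth_equalityI) (use that in auto)
  have 1: "adjacency_row (2 * n + 2) ?H i = adjacency_row n G1 i @ replicate n 0 @ [1, 0]"
    if "i < n" for i
  proof -
    have "map (\<lambda>j. if {i, j + n} \<in> edges ?H then 1 else 0) [0..<n] = replicate n (0 :: nat)"
      by (rule const) (use that in \<open>auto simp: iff\<close>)
    then show ?thesis
      unfolding split using that by (auto simp: iff adjacency_row_def)
  qed
  have 2: "adjacency_row (2 * n + 2) ?H (i + n) = replicate n 0 @ adjacency_row n G2 i @ [0, 1]"
    if "i < n" for i
  proof -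
    have "map (\<lambda>j. if {i + n, j} \<in> edges ?H then 1 else 0) [0..<n] = replicate n (0 :: nat)"
      by (rule const) (use that in \<open>auto simp: iff\<close>)
    then show ?thesis
      unfolding split using that by (auto simp: iff adjacency_row_def)
  qed
  have 3: "adjacency_row (2 * n + 2) ?H (2 * n) = replicate n 1 @ replicate n 0 @ [0, 1]"
  proof -
    have "map (\<lambda>j. if {2 * n, j} \<in> edges ?H then 1 else 0) [0..<n] = replicate n (1 :: nat)"
      by (rule const) (auto simp: iff)
    moreover have "map (\<lambda>j. if {2 * n, j + n} \<in> edges ?H then 1 else 0) [0..<n] = replicate n (0 :: nat)"
      by (rule const) (auto simp: iff)
    ultimately show ?thesis unfolding split by (simp only:) (simp add: iff)
  qed
  have 4: "adjacency_row (2 * n + 2) ?H (2 * n + 1) = replicate n 0 @ replicate n 1 @ [1, 0]"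
  proof -
    have "map (\<lambda>j. if {2 * n + 1, j} \<in> edges ?H then 1 else 0) [0..<n] = replicate n (0 :: nat)"
      by (rule const) (auto simp: iff)
    moreover have "map (\<lambda>j. if {2 * n + 1, j + n} \<in> edges ?H then 1 else 0) [0..<n] = replicate n (1 :: nat)"
      by (rule const) (auto simp: iff)
    ultimately show ?thesis unfolding split by (simp only:) (simp add: iff)
  qed
  have "map (adjacency_row (2 * n + 2) ?H) [0..<2 * n + 2] =
      map (\<lambda>i. adjacency_row n G1 i @ replicate n 0 @ [1, 0]) [0..<n] @
      map (\<lambda>i. replicate n 0 @ adjacency_row n G2 i @ [0, 1]) [0..<n] @
      [replicate n 1 @ replicate n 0 @ [0, 1], replicate n 0 @ replicate n 1 @ [1, 0]]"
    unfolding upt_join using 1 2 3 4 by simp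
  then show ?thesis unfolding encode_graph_rows by simp
qed

section \<open>The program\<close>

text \<open>Register 1 holds the number of vertices, register 2 the reading position in the input,
  registers 3 and 4 are counters of the outer and of the inner loops.\<close>

definition machine_state :: "nat \<Rightarrow> nat \<Rightarrow> nat \<Rightarrow> nat \<Rightarrow> nat list \<Rightarrow> state" where
  "machine_state n p i j q =
     \<lparr> regs = (\<lambda>_. 0)(1 := n, 2 := p, 3 := i, 4 := j), mem = (\<lambda>_. 0),
       query_tape = q, answer_tape = [] \<rparr>"

text \<open>Every loop of the program runs \<open>n\<close> times, so the bound is fixed to register
  1. Counting down makes the counter itself the loop condition and leaves it at 0.\<close>

definition for_loop :: "nat \<Rightarrow> prog \<Rightarrow> prog" where
  "for_loop r c = Seq (Assign r (Reg 1))
     (While (Reg r) (Seq c (Assign r (Minus (Reg r) (Const 1)))))"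

definition emit_n :: "nat \<Rightarrow> prog" where
  "emit_n b = for_loop 4 (Emit (Const b))"

definition copy_row :: prog where
  "copy_row = for_loop 4 (Seq (Emit (Input (Reg 2))) (Assign 2 (Plus (Reg 2) (Const 1))))"

text \<open>The closing \<open>Skip\<close> takes a step of its own, which enters all time counts
  below.\<close>

fun seqs :: "prog list \<Rightarrow> prog" where
  "seqs [] = Skip"
| "seqs (c # cs) = Seq c (seqs cs)"

text \<open>The distance of two numbers: with truncated subtraction at most one summand is nonzero.
  It replaces the missing comparison.\<close>

definition differ :: "exp \<Rightarrow> exp \<Rightarrow> exp" where
  "differ e1 e2 = Plus (Minus e1 e2) (Minus e2 e1)"

text \<open>Position 1 is the start of the first matrix. After its \<open>n\<close> rows the reading
  position is at the vertex count of the second graph, which the increment between the two outer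
  loops skips.\<close>

definition write_apex_join :: prog where
  "write_apex_join = seqs
    [Emit (Plus (Plus (Reg 1) (Reg 1)) (Const 2)),
     Assign 2 (Const 1),
     for_loop 3 (seqs [copy_row, emit_n 0, Emit (Const 1), Emit (Const 0)]),
     Assign 2 (Plus (Reg 2) (Const 1)),
     for_loop 3 (seqs [emit_n 0, copy_row, Emit (Const 0), Emit (Const 1)]),
     emit_n 1, emit_n 0, Emit (Const 0), Emit (Const 1),
     emit_n 0, emit_n 1, Emit (Const 1), Emit (Const 0)]"

text \<open>The second encoding starts at position \<open>1 + n * n\<close>. For want of
  multiplication, \<open>n\<close> is added \<open>n\<close> times.\<close>

definition find_second :: prog where
  "find_second = seqs
    [Assign 1 (Input (Const 0)), Assign 2 (Const 1),
     for_loop 3 (Assign 2 (Plus (Reg 2) (Reg 1)))]"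

text \<open>The apexes are the vertices \<open>2 * n\<close> and \<open>2 * n + 1\<close>. One minus
  the distance of their labels is 1 if the labels agree and 0 otherwise.\<close>

definition compare_apexes :: prog where
  "compare_apexes = Assign 0 (Minus (Const 1)
     (differ (Answer (Plus (Reg 1) (Reg 1))) (Answer (Plus (Plus (Reg 1) (Reg 1)) (Const 1)))))"

text \<open>Graphs of different orders are rejected by leaving register 0 at its initial value 0.
  Two empty graphs are accepted outright, since their joined graph would not be doubly
  connected.\<close>

definition isomorphism_program :: prog where
  "isomorphism_program = Seq find_second
    (Cond (differ (Reg 1) (Input (Reg 2)))
       Skip
       (Cond (Reg 1)
          (Seq write_apex_join (Seq Query compare_apexes))
          (Assign 0 (Const 1))))"

section \<open>Symbolic execution of assignments, output and loops\<close>

lemma init_state_eq: "init_state = machine_state 0 0 0 0 []"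
  by (simp add: init_state_def machine_state_def fun_eq_iff)

text \<open>With the update rules that follow, the states inside the loops stay in the form
  \<open>machine_state\<close>, so runs are computed by simplification. Register 1 appears as
  \<open>Suc 0\<close>, its simp normal form.\<close>

lemma eval_machine_state [simp]:
  "regs (machine_state n p i j q) 0 = 0"
  "regs (machine_state n p i j q) (Suc 0) = n"
  "regs (machine_state n p i j q) 2 = p"
  "regs (machine_state n p i j q) 3 = i"
  "regs (machine_state n p i j q) 4 = j"
  "query_tape (machine_state n p i j q) = q"
  by (simp_all add: machine_state_def)

lemma update_machine_state [simp]:
  "machine_state n p i j q\<lparr>regs := (regs (machine_state n p i j q))(Suc 0 := v)\<rparr> =
     machine_state v p i j q"
  "machine_state n p i j q\<lparr>regs := (regs (machine_state n p i j q))(2 := v)\<rparr> =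
     machine_state n v i j q"
  "machine_state n p i j q\<lparr>regs := (regs (machine_state n p i j q))(3 := v)\<rparr> =
     machine_state n p v j q"
  "machine_state n p i j q\<lparr>regs := (regs (machine_state n p i j q))(4 := v)\<rparr> =
     machine_state n p i v q"
  "machine_state n p i j q\<lparr>query_tape := q'\<rparr> = machine_state n p i j q'"
  by (simp_all add: machine_state_def fun_eq_iff)

lemma exec_Assign_machine_state:
  fixes n p i j q
  defines "s \<equiv> machine_state n p i j q"
  shows "exec A x (Assign 1 e) s 1 [] (machine_state (eval_exp x s e) p i j q)"
    and "exec A x (Assign 2 e) s 1 [] (machine_state n (eval_exp x s e) i j q)"
    and "exec A x (Assign 3 e) s 1 [] (machine_state n p (eval_exp x s e) j q)"
    and "exec A x (Assign 4 e) s 1 [] (machine_state n p i (eval_exp x s e) q)"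
  using exec.Assign[of A x 1 e s] exec.Assign[of A x 2 e s] exec.Assign[of A x 3 e s]
    exec.Assign[of A x 4 e s]
  unfolding s_def by simp_all

lemma exec_Emit_machine_state:
  "exec A x (Emit e) (machine_state n p i j q) 1 []
     (machine_state n p i j (q @ [eval_exp x (machine_state n p i j q) e]))"
  using exec.Emit[of A x e "machine_state n p i j q"] by simp

text \<open>Avoids query lists of the form \<open>[] @ qs\<close>, which would obstruct unification;
  everything before the oracle call is silent.\<close>

lemma exec_Seq_silent:
  "exec A x c1 s t1 [] s1 \<Longrightarrow> exec A x c2 s1 t2 qs s2 \<Longrightarrow> exec A x (Seq c1 c2) s (t1 + t2) qs s2"
  using exec.Seq[of A x c1 s t1 "[]" s1 c2 t2 qs s2] by simp

text \<open>\<open>S k\<close> is the state after \<open>k\<close> rounds. Each round costs the body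
  and one test, and the failing test adds 1. The induction peels off the first round, hence the
  shifted sequence \<open>S (Suc k)\<close>.\<close>

lemma exec_While_count:
  assumes "\<And>k. k < n \<Longrightarrow> eval_exp x (S k) b \<noteq> 0"
    and "\<And>k. k < n \<Longrightarrow> exec A x c (S k) t [] (S (Suc k))"
    and "eval_exp x (S n) b = 0"
  shows "exec A x (While b c) (S 0) (n * (t + 1) + 1) [] (S n)"
  using assms
proof (induction n arbitrary: S)
  case 0
  then show ?case using exec.While_False[of x "S 0" b A c] by simp
next
  case (Suc n)
  have "exec A x (While b c) (S (Suc 0)) (n * (t + 1) + 1) [] (S (Suc n))"
    using Suc.IH[of "\<lambda>k. S (Suc k)"] Suc.prems by simp
  from exec.While_True[OF Suc.prems(1)[of 0] Suc.prems(2)[of 0] this]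
  show ?case by (simp add: algebra_simps)
qed

text \<open>The body is run for an arbitrary counter value \<open>i\<close>, because it may not
  depend on the counter. Per round the test and the decrement add 2; the initial assignment and the
  last test add the final 2.\<close>

lemma exec_outer_loop:
  assumes body: "\<And>k i. k < n \<Longrightarrow>
      exec A x c (machine_state n (p k) i 0 (q k)) t [] (machine_state n (p (Suc k)) i 0 (q (Suc k)))"
    and "p 0 = p0" and "q 0 = q0"
  shows "exec A x (for_loop 3 c) (machine_state n p0 i 0 q0) (n * (t + 2) + 2) []
    (machine_state n (p n) 0 0 (q n))"
proof -
  let ?S = "\<lambda>k. machine_state n (p k) (n - k) 0 (q k)"
  have "exec A x (Seq c (Assign 3 (Minus (Reg 3) (Const 1)))) (?S k) (t + 1) [] (?S (Suc k))"
    if "k < n" for k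
    using exec_Seq_silent[OF body[OF that] exec_Assign_machine_state(3),
        of "Minus (Reg 3) (Const 1)" "n - k"] by simp
  then have "exec A x (While (Reg 3) (Seq c (Assign 3 (Minus (Reg 3) (Const 1)))))
      (?S 0) (n * ((t + 1) + 1) + 1) [] (?S n)"
    by (intro exec_While_count) auto
  then have loop: "exec A x (While (Reg 3) (Seq c (Assign 3 (Minus (Reg 3) (Const 1)))))
      (machine_state n p0 n 0 q0) (n * (t + 2) + 1) [] (?S n)"
    using assms(2,3) by simp
  have "exec A x (Assign 3 (Reg 1)) (machine_state n p0 i 0 q0) 1 [] (machine_state n p0 n 0 q0)"
    using exec_Assign_machine_state(3)[of A x "Reg 1" n p0 i 0 q0] by simp
  from this loop have "exec A x (for_loop 3 c) (machine_state n p0 i 0 q0) (1 + (n * (t + 2) + 1)) [] (?S n)"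
    unfolding for_loop_def by (rule exec_Seq_silent)
  then show ?thesis by simp
qed

lemma exec_inner_loop:
  assumes body: "\<And>k j. k < n \<Longrightarrow>
      exec A x c (machine_state n (p k) i j (q k)) t [] (machine_state n (p (Suc k)) i j (q (Suc k)))"
    and "p 0 = p0" and "q 0 = q0"
  shows "exec A x (for_loop 4 c) (machine_state n p0 i j q0) (n * (t + 2) + 2) []
    (machine_state n (p n) i 0 (q n))"
proof -
  let ?S = "\<lambda>k. machine_state n (p k) i (n - k) (q k)"
  have "exec A x (Seq c (Assign 4 (Minus (Reg 4) (Const 1)))) (?S k) (t + 1) [] (?S (Suc k))"
    if "k < n" for k
    using exec_Seq_silent[OF body[OF that] exec_Assign_machine_state(4),
        of "Minus (Reg 4) (Const 1)" "n - k"] by simp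
  then have "exec A x (While (Reg 4) (Seq c (Assign 4 (Minus (Reg 4) (Const 1)))))
      (?S 0) (n * ((t + 1) + 1) + 1) [] (?S n)"
    by (intro exec_While_count) auto
  then have loop: "exec A x (While (Reg 4) (Seq c (Assign 4 (Minus (Reg 4) (Const 1)))))
      (machine_state n p0 i n q0) (n * (t + 2) + 1) [] (?S n)"
    using assms(2,3) by simp
  have "exec A x (Assign 4 (Reg 1)) (machine_state n p0 i j q0) 1 [] (machine_state n p0 i n q0)"
    using exec_Assign_machine_state(4)[of A x "Reg 1" n p0 i j q0] by simp
  from this loop have "exec A x (for_loop 4 c) (machine_state n p0 i j q0) (1 + (n * (t + 2) + 1)) [] (?S n)"
    unfolding for_loop_def by (rule exec_Seq_silent)
  then show ?thesis by simp
qed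

section \<open>Runs of the subprograms with exact step counts\<close>

lemma exec_emit_n:
  "exec A x (emit_n b) (machine_state n p i 0 q) (n * (1 + 2) + 2) []
     (machine_state n p i 0 (q @ replicate n b))"
  unfolding emit_n_def
proof (rule exec_inner_loop[where p = "\<lambda>_. p" and q = "\<lambda>k. q @ replicate k b"])
  show "exec A x (Emit (Const b)) (machine_state n p i j (q @ replicate k b)) 1 []
      (machine_state n p i j (q @ replicate (Suc k) b))" for k j
    using exec_Emit_machine_state[of A x "Const b" n p i j "q @ replicate k b"]
    by (simp add: replicate_append_same)
qed simp_all

text \<open>The time is kept in the shape that the loop rule produces, so that rules chain by
  unification; arithmetic is done only at the end.\<close>

lemma exec_copy_row:
  "exec A x copy_row (machine_state n p i 0 q) (n * ((1 + 1) + 2) + 2) []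
     (machine_state n (p + n) i 0 (q @ map (nth0 x) [p..<p + n]))"
  unfolding copy_row_def
proof (rule exec_inner_loop[where p = "\<lambda>k. p + k" and q = "\<lambda>k. q @ map (nth0 x) [p..<p + k]"])
  fix k j
  show "exec A x (Seq (Emit (Input (Reg 2))) (Assign 2 (Plus (Reg 2) (Const 1))))
      (machine_state n (p + k) i j (q @ map (nth0 x) [p..<p + k])) (1 + 1) []
      (machine_state n (p + Suc k) i j (q @ map (nth0 x) [p..<p + Suc k]))"
    using exec_Seq_silent[OF exec_Emit_machine_state exec_Assign_machine_state(2),
        of A x "Input (Reg 2)" "Plus (Reg 2) (Const 1)" n "p + k" i j "q @ map (nth0 x) [p..<p + k]"]
    by simp
qed simp_all

text \<open>The premise \<open>s = s'\<close> postpones the comparison of final states: chaining the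
  rules leaves just this equation.\<close>

lemma exec_seqs:
  "s = s' \<Longrightarrow> exec A x (seqs []) s 1 [] s'"
  "exec A x c s t1 [] s1 \<Longrightarrow> exec A x (seqs cs) s1 t2 qs s2 \<Longrightarrow>
     exec A x (seqs (c # cs)) s (t1 + t2) qs s2"
  using exec.Skip[of A x s] by (simp_all add: exec_Seq_silent)

lemma exec_Emit_Const:
  "exec A x (Emit (Const b)) (machine_state n p i j q) 1 [] (machine_state n p i j (q @ [b]))"
  using exec_Emit_machine_state[of A x "Const b"] by simp

lemma exec_set_position:
  "exec A x (Assign 2 (Const k)) (machine_state n p i j q) 1 [] (machine_state n k i j q)"
  "exec A x (Assign 2 (Plus (Reg 2) (Const k))) (machine_state n p i j q) 1 []
     (machine_state n (p + k) i j q)"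
  using exec_Assign_machine_state(2)[of A x "Const k" n p i j q]
    exec_Assign_machine_state(2)[of A x "Plus (Reg 2) (Const k)" n p i j q] by simp_all

lemmas exec_rules = exec_seqs exec_copy_row exec_emit_n exec_Emit_Const exec_set_position

lemma exec_rows_left:
  assumes row: "\<And>i. i < n \<Longrightarrow> map (nth0 x) [p + i * n..<p + i * n + n] = row i"
  shows "exec A x (for_loop 3 (seqs [copy_row, emit_n 0, Emit (Const 1), Emit (Const 0)])) (machine_state n p 0 0 q)
    (n * ((7 * n + 7) + 2) + 2) []
    (machine_state n (p + n * n) 0 0 (q @ concat (map (\<lambda>i. row i @ replicate n 0 @ [1, 0]) [0..<n])))"
proof (rule exec_outer_loop[where p = "\<lambda>k. p + k * n" and
      q = "\<lambda>k. q @ concat (map (\<lambda>i. row i @ replicate n 0 @ [1, 0]) [0..<k])"])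
  fix k i assume "k < n"
  let ?q = "\<lambda>k. q @ concat (map (\<lambda>i. row i @ replicate n 0 @ [1, 0]) [0..<k])"
  have "exec A x (seqs [copy_row, emit_n 0, Emit (Const 1), Emit (Const 0)])
      (machine_state n (p + k * n) i 0 (?q k)) ((n * ((1 + 1) + 2) + 2) + ((n * (1 + 2) + 2) + (1 + (1 + 1)))) []
      (machine_state n (p + Suc k * n) i 0 (?q (Suc k)))"
    \<comment> \<open>The simplification by \<open>row\<close> precedes \<open>add_ac\<close>, while
      the interval bounds still have the form that \<open>row\<close> matches.\<close>
    by (rule exec_rules)+ (simp add: row[OF \<open>k < n\<close>], simp add: add_ac)
  \<comment> \<open>Copying a row costs \<open>4 * n + 2\<close>, the constant block
    \<open>3 * n + 2\<close>, two single outputs and the closing \<open>Skip\<close> 3.\<close>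
  moreover have "(n * ((1 + 1) + 2) + 2) + ((n * (1 + 2) + 2) + (1 + (1 + 1))) = 7 * n + 7"
    by simp
  ultimately show "exec A x (seqs [copy_row, emit_n 0, Emit (Const 1), Emit (Const 0)])
      (machine_state n (p + k * n) i 0 (?q k)) (7 * n + 7) []
      (machine_state n (p + Suc k * n) i 0 (?q (Suc k)))"
    by (simp only:)
qed simp_all

lemma exec_rows_right:
  assumes row: "\<And>i. i < n \<Longrightarrow> map (nth0 x) [p + i * n..<p + i * n + n] = row i"
  shows "exec A x (for_loop 3 (seqs [emit_n 0, copy_row, Emit (Const 0), Emit (Const 1)])) (machine_state n p 0 0 q)
    (n * ((7 * n + 7) + 2) + 2) []
    (machine_state n (p + n * n) 0 0 (q @ concat (map (\<lambda>i. replicate n 0 @ row i @ [0, 1]) [0..<n])))"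
proof (rule exec_outer_loop[where p = "\<lambda>k. p + k * n" and
      q = "\<lambda>k. q @ concat (map (\<lambda>i. replicate n 0 @ row i @ [0, 1]) [0..<k])"])
  fix k i assume "k < n"
  let ?q = "\<lambda>k. q @ concat (map (\<lambda>i. replicate n 0 @ row i @ [0, 1]) [0..<k])"
  have "exec A x (seqs [emit_n 0, copy_row, Emit (Const 0), Emit (Const 1)])
      (machine_state n (p + k * n) i 0 (?q k)) ((n * (1 + 2) + 2) + ((n * ((1 + 1) + 2) + 2) + (1 + (1 + 1)))) []
      (machine_state n (p + Suc k * n) i 0 (?q (Suc k)))"
    by (rule exec_rules)+ (simp add: row[OF \<open>k < n\<close>], simp add: add_ac)
  moreover have "(n * (1 + 2) + 2) + ((n * ((1 + 1) + 2) + 2) + (1 + (1 + 1))) = 7 * n + 7"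
    by simp
  ultimately show "exec A x (seqs [emit_n 0, copy_row, Emit (Const 0), Emit (Const 1)])
      (machine_state n (p + k * n) i 0 (?q k)) (7 * n + 7) []
      (machine_state n (p + Suc k * n) i 0 (?q (Suc k)))"
    by (simp only:)
qed simp_all

lemma exec_write_apex_join:
  assumes G: "numbered_graph n G1" "numbered_graph n G2"
  shows "exec A (encode_graph n G1 @ encode_graph n G2) write_apex_join (machine_state n p 0 0 [])
    (14 * (n * n) + 30 * n + 20) []
    (machine_state n (1 + n * n + 1 + n * n) 0 0 (encode_graph (2 * n + 2) (apex_join n G1 G2)))"
proof -
  let ?x = "encode_graph n G1 @ encode_graph n G2"
  \<comment> \<open>The costs of the commands in program order, the last 1 being that of
    \<open>Skip\<close>: two outer loops of \<open>7 * n * n + 9 * n + 2\<close>, four constant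
    blocks of \<open>3 * n + 2\<close>, and 8 single steps.\<close>
  let ?T = "1 + (1 + ((n * ((7 * n + 7) + 2) + 2) + (1 + ((n * ((7 * n + 7) + 2) + 2) +
    ((n * (1 + 2) + 2) + ((n * (1 + 2) + 2) + (1 + (1 + ((n * (1 + 2) + 2) + ((n * (1 + 2) + 2) + (1 + (1 + 1))))))))))))"
  have left: "map (nth0 ?x) [1 + i * n..<1 + i * n + n] = adjacency_row n G1 i" if "i < n" for i
    using map_nth0_encode_graph[OF that, of "1 + i * n" "[]" G1 "encode_graph n G2"] by simp
  have right: "map (nth0 ?x) [1 + n * n + 1 + i * n..<1 + n * n + 1 + i * n + n] =
      adjacency_row n G2 i" if "i < n" for i
    using map_nth0_encode_graph[OF that, of "1 + n * n + 1 + i * n" "encode_graph n G1" G2 "[]"]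
    by (simp add: length_encode_graph)
  have "exec A ?x write_apex_join (machine_state n p 0 0 []) ?T []
    (machine_state n (1 + n * n + 1 + n * n) 0 0 (encode_graph (2 * n + 2) (apex_join n G1 G2)))"
    unfolding write_apex_join_def encode_apex_join[OF G]
    \<comment> \<open>\<open>assumption\<close> discharges the index bounds brought along by
      \<open>left\<close> and \<open>right\<close>; the final \<open>mult_2\<close> equates
      \<open>2 * n\<close> with the \<open>n + n\<close> that the program computes.\<close>
    by ((rule exec_rules exec_Emit_machine_state
        exec_rows_left[where row = "adjacency_row n G1", OF left]
        exec_rows_right[where row = "adjacency_row n G2", OF right] | assumption)+) (simp add: mult_2)
  moreover have "?T = 14 * (n * n) + 30 * n + 20"
    by (simp add: algebra_simps)
  ultimately show ?thesis by (simp only:)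
qed

lemma exec_find_second:
  "exec A (encode_graph n G1 @ xs) find_second init_state (3 * n + 5) []
     (machine_state n (1 + n * n) 0 0 [])"
proof -
  let ?x = "encode_graph n G1 @ xs"
  have first: "nth0 ?x 0 = n" by (simp add: nth0_def encode_graph_def)
  have "exec A ?x (Assign 1 (Input (Const 0))) init_state 1 [] (machine_state n 0 0 0 [])"
    using exec_Assign_machine_state(1)[of A ?x "Input (Const 0)" 0 0 0 0 "[]"]
    by (simp add: init_state_eq first)
  moreover have "exec A ?x (for_loop 3 (Assign 2 (Plus (Reg 2) (Reg 1)))) (machine_state n 1 0 0 [])
      (n * (1 + 2) + 2) [] (machine_state n (1 + n * n) 0 0 [])"
  proof (rule exec_outer_loop[where p = "\<lambda>k. 1 + k * n"])
    show "exec A ?x (Assign 2 (Plus (Reg 2) (Reg 1))) (machine_state n (1 + k * n) i 0 []) 1 []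
        (machine_state n (1 + Suc k * n) i 0 [])" for k i
      using exec_Assign_machine_state(2)[of A ?x "Plus (Reg 2) (Reg 1)" n "1 + k * n" i 0 "[]"]
      by (simp add: add_ac)
  qed simp_all
  ultimately have "exec A ?x find_second init_state (1 + (1 + ((n * (1 + 2) + 2) + 1))) []
      (machine_state n (1 + n * n) 0 0 [])"
    unfolding find_second_def by (blast intro: exec_rules refl)
  moreover have "1 + (1 + ((n * (1 + 2) + 2) + 1)) = 3 * n + 5" by simp
  ultimately show ?thesis by (simp only:)
qed

section \<open>The reduction\<close>

lemma isomorphic_same_order:
  assumes "numbered_graph n1 G1" and "numbered_graph n2 G2" and "isomorphic G1 G2"
  shows "n1 = n2"
proof -
  obtain \<beta> where "bij_betw \<beta> (verts G1) (verts G2)"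
    using assms(3) unfolding isomorphic_def by blast
  then have "card (verts G1) = card (verts G2)" by (rule bij_betw_same_card)
  with assms(1,2) show ?thesis by (simp add: numbered_graph_def)
qed

lemma isomorphic_no_vertices:
  assumes "numbered_graph 0 G1" and "numbered_graph 0 G2"
  shows "isomorphic G1 G2"
  by (simp add: isomorphic_iff_edges[OF assms] bij_betw_def)

text \<open>The bounds mention only \<open>n1\<close>, because the program goes on to the oracle
  only if the orders agree. The time adds up from \<open>3 * n1 + 5\<close> for finding the second
  graph, 2 for the tests, the writing of the query, and 2 for the call and the comparison. The one
  call is made only for \<open>0 < n1\<close>, so it respects the bound \<open>n1\<close>.\<close>

lemma isomorphism_program_correct:
  assumes A: "solves_automorphism_partitioning_dc A"
    and G: "numbered_graph n1 G1" "numbered_graph n2 G2"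
  shows "\<exists>t qs s. exec A (encode_graph n1 G1 @ encode_graph n2 G2) isomorphism_program init_state t qs s \<and>
    (accepting s \<longleftrightarrow> isomorphic G1 G2) \<and>
    t \<le> 14 * (n1 * n1) + 33 * n1 + 29 \<and>
    length qs \<le> n1 \<and>
    (\<forall>q\<in>set qs. \<exists>m H. numbered_graph m H \<and> doubly_connected H \<and> q = encode_graph m H)"
proof -
  let ?x = "encode_graph n1 G1 @ encode_graph n2 G2"
  let ?s = "machine_state n1 (1 + n1 * n1) 0 0 []"
  \<comment> \<open>The position just past the first encoding. Its length has to be used before
    \<open>encode_graph\<close> is unfolded, hence the two simplifications.\<close>
  have second: "nth0 ?x (1 + n1 * n1) = n2"
    by (simp add: nth0_def nth_append length_encode_graph) (simp add: encode_graph_def)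
  note find = exec_find_second[of A n1 G1 "encode_graph n2 G2"]
  consider "n1 \<noteq> n2" | "n1 = 0" "n2 = 0" | "n1 = n2" "0 < n1" by auto
  then show ?thesis
  proof cases
    case 1
    then have "eval_exp ?x ?s (differ (Reg 1) (Input (Reg 2))) \<noteq> 0"
      using second by (simp add: differ_def)
    then have "exec A ?x isomorphism_program init_state ((3 * n1 + 5) + (1 + 1)) [] ?s"
      unfolding isomorphism_program_def by (blast intro: exec_Seq_silent find exec.Cond_True exec.Skip)
    moreover have "\<not> accepting ?s" by (simp add: accepting_def)
    moreover have "\<not> isomorphic G1 G2" using isomorphic_same_order[OF G] 1 by blast
    ultimately show ?thesis by (intro exI[of _ "(3 * n1 + 5) + (1 + 1)"] exI[of _ "[]"] exI[of _ ?s]) simp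
  next
    case 2
    have "eval_exp ?x ?s (differ (Reg 1) (Input (Reg 2))) = 0" "eval_exp ?x ?s (Reg 1) = 0"
      using second 2 by (simp_all add: differ_def)
    then have "exec A ?x isomorphism_program init_state ((3 * n1 + 5) + (1 + (1 + 1))) []
        (?s\<lparr>regs := (regs ?s)(0 := eval_exp ?x ?s (Const 1))\<rparr>)"
      unfolding isomorphism_program_def
      by (blast intro: exec_Seq_silent find exec.Cond_False exec.Assign)
    moreover have "accepting (?s\<lparr>regs := (regs ?s)(0 := eval_exp ?x ?s (Const 1))\<rparr>)"
      by (simp add: accepting_def)
    moreover have "isomorphic G1 G2" using isomorphic_no_vertices G 2 by blast
    ultimately show ?thesis using 2
      by (intro exI[of _ "(3 * n1 + 5) + (1 + (1 + 1))"] exI[of _ "[]"] exI) auto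
  next
    case 3
    let ?H = "apex_join n1 G1 G2"
    let ?q = "encode_graph (2 * n1 + 2) ?H"
    let ?s1 = "machine_state n1 (1 + n1 * n1 + 1 + n1 * n1) 0 0 ?q"
    define ans where "ans = A ?q"
    let ?s2 = "?s1\<lparr>query_tape := [], answer_tape := ans\<rparr>"
    define e where "e = Minus (Const 1)
      (differ (Answer (Plus (Reg 1) (Reg 1))) (Answer (Plus (Plus (Reg 1) (Reg 1)) (Const 1))))"
    define s3 where "s3 = ?s2\<lparr>regs := (regs ?s2)(0 := eval_exp ?x ?s2 e)\<rparr>"
    have G': "numbered_graph n1 G1" "numbered_graph n1 G2" using G 3 by simp_all
    note H = numbered_graph_apex_join[OF G'] doubly_connected_apex_join[OF G' 3(2)]
    have part: "represents_partition ans (2 * n1 + 2) (automorphism_partition ?H)"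
      using A H unfolding solves_automorphism_partitioning_dc_def ans_def by blast
    \<comment> \<open>Both apex positions lie inside the answer, so \<open>nth0\<close> returns true
      labels and not its default 0.\<close>
    then have len: "length ans = 2 * n1 + 2" by (simp add: represents_partition_def)
    have differ: "Suc 0 - (a - b + (b - a)) = (if a = b then 1 else 0)" for a b :: nat
      by auto
    have "eval_exp ?x ?s2 e = (if ans ! (2 * n1) = ans ! (2 * n1 + 1) then 1 else 0)"
      by (simp add: e_def differ_def nth0_def len mult_2 differ)
    also have "ans ! (2 * n1) = ans ! (2 * n1 + 1) \<longleftrightarrow>
        (2 * n1, 2 * n1 + 1) \<in> automorphism_equivalence ?H"
      by (rule represents_automorphism_partition_iff[OF H(1) part]) simp_all
    also have "\<dots> \<longleftrightarrow> isomorphic G1 G2" by (rule apexes_equivalent_iff_isomorphic[OF G'])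
    finally have accept: "accepting s3 \<longleftrightarrow> isomorphic G1 G2"
      by (simp add: accepting_def s3_def)
    have cond: "eval_exp ?x ?s (differ (Reg 1) (Input (Reg 2))) = 0" "eval_exp ?x ?s (Reg 1) \<noteq> 0"
      using second 3 by (simp_all add: differ_def)
    have "exec A ?x Query ?s1 1 [?q] ?s2"
      using exec.Query[of A ?x ?s1] by (simp add: ans_def)
    moreover have "exec A ?x compare_apexes ?s2 1 [] s3"
      unfolding compare_apexes_def s3_def e_def by (rule exec.Assign)
    ultimately have "exec A ?x (Seq Query compare_apexes) ?s1 (1 + 1) ([?q] @ []) s3"
      by (rule exec.Seq)
    moreover have "exec A ?x write_apex_join ?s (14 * (n1 * n1) + 30 * n1 + 20) [] ?s1"
      using exec_write_apex_join[OF G'] 3 by simp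
    ultimately have "exec A ?x (Seq write_apex_join (Seq Query compare_apexes)) ?s
        (14 * (n1 * n1) + 30 * n1 + 20 + (1 + 1)) ([?q] @ []) s3"
      by (rule exec_Seq_silent[rotated])
    then have "exec A ?x isomorphism_program init_state
        (3 * n1 + 5 + (1 + (1 + (14 * (n1 * n1) + 30 * n1 + 20 + (1 + 1))))) ([?q] @ []) s3"
      unfolding isomorphism_program_def
      by (intro exec_Seq_silent[OF find] exec.Cond_False[OF cond(1)] exec.Cond_True[OF cond(2)])
    with accept H 3(2) show ?thesis
      by (intro exI[of _ "3 * n1 + 5 + (1 + (1 + (14 * (n1 * n1) + 30 * n1 + 20 + (1 + 1))))"]
          exI[of _ "[?q] @ []"] exI[of _ s3]) auto
  qed
qed

theorem theorem2:
  "\<exists>(c :: prog) (p :: nat poly).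
     \<forall>A. solves_automorphism_partitioning_dc A \<longrightarrow>
       (\<forall>n1 n2 G1 G2. numbered_graph n1 G1 \<and> numbered_graph n2 G2 \<longrightarrow>
          (\<exists>t qs s. exec A (encode_graph n1 G1 @ encode_graph n2 G2) c init_state t qs s \<and>
             (accepting s \<longleftrightarrow> isomorphic G1 G2) \<and>
             t \<le> poly p (max n1 n2) \<and>
             length qs \<le> max n1 n2 \<and>
             (\<forall>q\<in>set qs. \<exists>m H. numbered_graph m H \<and> doubly_connected H \<and>
                q = encode_graph m H)))"
proof -
  \<comment> \<open>The coefficients of the bound in \<open>isomorphism_program_correct\<close>,
    constant term first. As natural numbers they make the polynomial monotone, so \<open>n1\<close>
    may be replaced by the maximum.\<close>
  let ?p = "[:29, 33, 14:] :: nat poly"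
  have bound: "14 * (n1 * n1) + 33 * n1 + 29 \<le> poly ?p (max n1 n2)" for n1 n2 :: nat
  proof -
    have "n1 * n1 \<le> max n1 n2 * max n1 n2" by (intro mult_mono) simp_all
    moreover have "n1 \<le> max n1 n2" by simp
    moreover have "poly ?p (max n1 n2) = 14 * (max n1 n2 * max n1 n2) + 33 * max n1 n2 + 29"
      by (simp add: algebra_simps)
    ultimately show ?thesis by (simp only: add_mono mult_le_mono)
  qed
  show ?thesis
  proof (rule exI[of _ isomorphism_program], rule exI[of _ ?p], intro allI impI, elim conjE)
    fix A n1 n2 G1 G2
    assume "solves_automorphism_partitioning_dc A" "numbered_graph n1 G1" "numbered_graph n2 G2"
    from isomorphism_program_correct[OF this] bound[of n1 n2] max.cobounded1[of n1 n2]
    show "\<exists>t qs s. exec A (encode_graph n1 G1 @ encode_graph n2 G2) isomorphism_program init_state t qs s \<and>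
        (accepting s \<longleftrightarrow> isomorphic G1 G2) \<and>
        t \<le> poly ?p (max n1 n2) \<and>
        length qs \<le> max n1 n2 \<and>
        (\<forall>q\<in>set qs. \<exists>m H. numbered_graph m H \<and> doubly_connected H \<and> q = encode_graph m H)"
      by (meson order_trans)
  qed
qed

end
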